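(* Let $\mathcal H$ and $\mathcal K$ be separable complex Krein spaces, $A\in L(\mathcal K,\mathcal H)$ and $W\in L(\mathcal H)$ selfadjoint ($W=W^{\#}$). Then the following statements are equivalent: (i) the equation $Az=x$ admits an indefinite weighted least squares solution ($W$-ILSS) for every $x\in\mathcal H$; (ii) $\operatorname{ran}A+[W(\operatorname{ran}A)]^{[\perp]}=\mathcal H$ and $\operatorname{ran}A$ is $W$-nonnegative; (iii) the normal equation $A^{\#}W(AX-I)=0$ admits a solution $X\in L(\mathcal H,\mathcal K)$ and $\operatorname{ran}A$ is $W$-nonnegative; (iv) the operator $A$ admits an indefinite $W$-inverse. In this case, the set of indefinite $W$-inverses of $A$ is the set of solutions $X\in L(\mathcal H,\mathcal K)$ of $A^{\#}W(AX-I)=0$.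
   Context: A Krein space is a complex vector space with an indefinite inner product $[\cdot,\cdot]$ admitting a $[\cdot,\cdot]$-orthogonal direct sum decomposition (fundamental decomposition) $\mathcal H=\mathcal H_+[\dotplus]\mathcal H_-$ with $(\mathcal H_+,[\cdot,\cdot])$ and $(\mathcal H_-,-[\cdot,\cdot])$ Hilbert spaces. The associated signature operator is $J=P_+-P_-$, where $P_\pm$ is the projection onto $\mathcal H_\pm$ along $\mathcal H_\mp$, and $\langle x,y\rangle_J=[Jx,y]$ is a Hilbert space inner product; all such inner products give equivalent norms. $L(\mathcal K,\mathcal H)$ is the set of linear operators $\mathcal K\to\mathcal H$ bounded with respect to these norms, $L(\mathcal H)=L(\mathcal H,\mathcal H)$. For an operator $T$, $T^{\#}$ denotes its adjoint with respect to the indefinite inner products. For a set $\mathcal S\subseteq\mathcal H$, $\mathcal S^{[\perp]}=\{h\in\mathcal H:[h,s]=0\ \forall s\in\mathcal S\}$. A subspace $\mathcal S$ is $W$-nonnegative if $[Ws,s]\ge0$ for every $s\in\mathcal S$. Given $x\in\mathcal H$, a $W$-ILSS of $Az=x$ is a vector $u\in\mathcal K$ such that $[W(Au-x),Au-x]\le[W(Az-x),Az-x]$ for every $z\in\mathcal K$. An operator $G\in L(\mathcal H,\mathcal K)$ is an indefinite $W$-inverse of $A$ if for each $x\in\mathcal H$, $Gx$ is a $W$-ILSS of $Az=x$. The range of $A$ is not assumed to be closed. *)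

theory Defs
  imports
    "HOL-Analysis.Analysis"
    "HOL-Library.Complex_Order"
    "HOL-Library.Set_Algebras"
begin

text \<open>
  Comparisons of complex numbers are those of \<^theory>\<open>HOL-Library.Complex_Order\<close>:
  \<^term>\<open>a \<le> (b::complex)\<close> means that the imaginary parts agree and
  \<^term>\<open>Re a \<le> Re b\<close>; in particular \<^term>\<open>0 \<le> (b::complex)\<close> says that \<^term>\<open>b\<close> is real and
  nonnegative. The sum of two sets of vectors is the Minkowski sum of
  \<^theory>\<open>HOL-Library.Set_Algebras\<close>.
\<close>


section \<open>Complex vector spaces with an indefinite inner product\<close>

class complex_vector = ab_group_add +
  fixes scaleC :: "complex \<Rightarrow> 'a \<Rightarrow> 'a"  (infixr \<open>*\<^sub>C\<close> 75)
  assumes scaleC_add_right: "a *\<^sub>C (x + y) = a *\<^sub>C x + a *\<^sub>C y"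
    and scaleC_add_left: "(a + b) *\<^sub>C x = a *\<^sub>C x + b *\<^sub>C x"
    and scaleC_scaleC: "a *\<^sub>C b *\<^sub>C x = (a * b) *\<^sub>C x"
    and scaleC_one: "1 *\<^sub>C x = x"

global_interpretation complex_vector: vector_space "scaleC :: complex \<Rightarrow> 'a \<Rightarrow> 'a::complex_vector"
  by unfold_locales (rule scaleC_add_right scaleC_add_left scaleC_scaleC scaleC_one)+

text \<open>
  Class-context form of \<^term>\<open>complex_vector.subspace\<close>, which lives on a fixed sort and hence
  cannot be used in the class specifications below.
\<close>

definition (in complex_vector) csubspace :: "'a set \<Rightarrow> bool" where
  "csubspace S \<longleftrightarrow>
     0 \<in> S \<and> (\<forall>x\<in>S. \<forall>y\<in>S. x + y \<in> S) \<and> (\<forall>c. \<forall>x\<in>S. c *\<^sub>C x \<in> S)"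

lemma csubspace_iff_subspace: "csubspace S \<longleftrightarrow> complex_vector.subspace S"
  by (auto simp: csubspace_def complex_vector.subspace_def)

text \<open>
  Nondegeneracy is not an axiom: it follows from the existence of a fundamental decomposition.
\<close>

class iip_space = complex_vector +
  fixes iip :: "'a \<Rightarrow> 'a \<Rightarrow> complex"
  assumes iip_add_left: "iip (x + y) z = iip x z + iip y z"
    and iip_scaleC_left: "iip (c *\<^sub>C x) y = c * iip x y"
    and iip_commute: "iip x y = cnj (iip y x)"

text \<open>
  For a positive definite form the metric below is the usual one. The modulus only makes it
  nonnegative off \<open>S\<close> as well, where the form may be indefinite, because the locale
  \<^locale>\<open>Metric_space\<close> asks for a nonnegative function on the whole type.
\<close>

definition (in ab_group_add) form_dist :: "('a \<Rightarrow> 'a \<Rightarrow> complex) \<Rightarrow> 'a \<Rightarrow> 'a \<Rightarrow> real" where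
  "form_dist f x y = sqrt (cmod (f (x - y) (x - y)))"

definition (in complex_vector) hilbert_space_on :: "'a set \<Rightarrow> ('a \<Rightarrow> 'a \<Rightarrow> complex) \<Rightarrow> bool" where
  "hilbert_space_on S f \<longleftrightarrow>
     csubspace S \<and>
     (\<forall>x\<in>S. \<forall>y\<in>S. \<forall>z\<in>S. f (x + y) z = f x z + f y z) \<and>
     (\<forall>c. \<forall>x\<in>S. \<forall>y\<in>S. f (c *\<^sub>C x) y = c * f x y) \<and>
     (\<forall>x\<in>S. \<forall>y\<in>S. f x y = cnj (f y x)) \<and>
     (\<forall>x\<in>S. x \<noteq> 0 \<longrightarrow> 0 < f x x) \<and>
     Metric_space.mcomplete S (form_dist f)"


section \<open>Krein spaces\<close>

definition (in iip_space) fundamental_decomposition :: "'a set \<Rightarrow> 'a set \<Rightarrow> bool" where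
  "fundamental_decomposition M N \<longleftrightarrow>
     hilbert_space_on M iip \<and>
     hilbert_space_on N (\<lambda>x y. - iip x y) \<and>
     (\<forall>x\<in>M. \<forall>y\<in>N. iip x y = 0) \<and>
     (\<forall>z. \<exists>x\<in>M. \<exists>y\<in>N. z = x + y) \<and> M \<inter> N = {0}"

class krein_space = iip_space +
  assumes ex_fundamental_decomposition: "\<exists>M N. fundamental_decomposition M N"

text \<open>\<open>proj_along M N\<close> is the projection onto \<open>M\<close> along \<open>N\<close>.\<close>

definition (in ab_group_add) proj_along :: "'a set \<Rightarrow> 'a set \<Rightarrow> 'a \<Rightarrow> 'a" where
  "proj_along M N x = (THE u. u \<in> M \<and> x - u \<in> N)"

definition (in ab_group_add) signature_op :: "'a set \<Rightarrow> 'a set \<Rightarrow> 'a \<Rightarrow> 'a" where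
  "signature_op M N x = proj_along M N x - proj_along N M x"

definition (in iip_space) inner_J :: "'a set \<Rightarrow> 'a set \<Rightarrow> 'a \<Rightarrow> 'a \<Rightarrow> complex" where
  "inner_J M N x y = iip (signature_op M N x) y"

definition (in iip_space) norm_J :: "'a set \<Rightarrow> 'a set \<Rightarrow> 'a \<Rightarrow> real" where
  "norm_J M N x = sqrt (Re (inner_J M N x x))"

text \<open>
  All fundamental decompositions induce equivalent norms, so it does not matter that separability
  refers to one of them and boundedness to each of them.
\<close>

class separable_krein_space = krein_space +
  assumes separable: "\<exists>M N. fundamental_decomposition M N \<and>
    separable_space (Metric_space.mtopology UNIV (form_dist (inner_J M N)))"

definition bounded_ops :: "('a::krein_space \<Rightarrow> 'b::krein_space) set" where
  "bounded_ops = {T. Vector_Spaces.linear scaleC scaleC T \<and>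
     (\<forall>M N M' N'. fundamental_decomposition M N \<longrightarrow> fundamental_decomposition M' N' \<longrightarrow>
        (\<exists>C. \<forall>x. norm_J M' N' (T x) \<le> C * norm_J M N x))}"

definition iip_adjoint :: "('a::krein_space \<Rightarrow> 'b::krein_space) \<Rightarrow> 'b \<Rightarrow> 'a" where
  "iip_adjoint T = (THE S. \<forall>x y. iip (T x) y = iip x (S y))"

definition iip_perp :: "'a::krein_space set \<Rightarrow> 'a set" where
  "iip_perp S = {h. \<forall>s\<in>S. iip h s = 0}"


section \<open>Indefinite weighted least squares\<close>

definition weighted_nonneg :: "('a::krein_space \<Rightarrow> 'a) \<Rightarrow> 'a set \<Rightarrow> bool" where
  "weighted_nonneg W S \<longleftrightarrow> (\<forall>s\<in>S. 0 \<le> iip (W s) s)"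

definition is_WILSS ::
    "('h::krein_space \<Rightarrow> 'h) \<Rightarrow> ('k::krein_space \<Rightarrow> 'h) \<Rightarrow> 'h \<Rightarrow> 'k \<Rightarrow> bool" where
  "is_WILSS W A x u \<longleftrightarrow>
     (\<forall>z. iip (W (A u - x)) (A u - x) \<le> iip (W (A z - x)) (A z - x))"

definition indefinite_W_inverse ::
    "('h::krein_space \<Rightarrow> 'h) \<Rightarrow> ('k::krein_space \<Rightarrow> 'h) \<Rightarrow> ('h \<Rightarrow> 'k) \<Rightarrow> bool" where
  "indefinite_W_inverse W A G \<longleftrightarrow> G \<in> bounded_ops \<and> (\<forall>x. is_WILSS W A x (G x))"

definition normal_equation ::
    "('h::krein_space \<Rightarrow> 'h) \<Rightarrow> ('k::krein_space \<Rightarrow> 'h) \<Rightarrow> ('h \<Rightarrow> 'k) \<Rightarrow> bool" where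
  "normal_equation W A X \<longleftrightarrow> iip_adjoint A \<circ> W \<circ> (\<lambda>x. A (X x) - x) = (\<lambda>_. 0)"

end

theory Submission
  imports Defs
begin

text \<open>
  Expanding the quadratic form \<open>[Wv, v]\<close> along \<open>v = (Au - x) + c Az\<close> shows that \<open>u\<close> is a
  \<open>W\<close>-ILSS of \<open>Az = x\<close> iff the range of \<open>A\<close> is \<open>W\<close>-nonnegative and \<open>A\<^sup># W (Au - x) = 0\<close>. Hence,
  given nonnegativity, solvability for every \<open>x\<close> means \<open>ran (A\<^sup># W) \<subseteq> ran (A\<^sup># W A)\<close>, which is a
  rewording of the range condition (ii). That the pointwise solutions can be chosen linear and
  bounded, as (iii) and (iv) demand, is the factorization lemma of Douglas; it needs no closed
  range.
\<close>


section \<open>Hermitian forms\<close>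

text \<open>The obstacle is that a Krein space carries no preferred norm: every fundamental
  decomposition yields its own Hilbert inner product on the same type. Hilbert space theory is
  therefore developed in locales with the form as a parameter, so that two decompositions can be
  compared side by side. Membership in \<open>bounded_ops\<close>, which quantifies over all
  decompositions, becomes checkable on a single pair once their norms are known to be equivalent.
  The uniform boundedness principle carries the analysis: it yields this equivalence and, later, the
  boundedness of the factor in Douglas's lemma. It is applied to scalar functionals only, and
  duality turns the resulting bounds back into bounds on norms. Since ranges need not be closed, a
  point of a closure is represented by a sequence converging to it. One variational lemma for
  Hermitian forms, free of any definiteness, serves both the weighted form and the nearest point in
  a Hilbert space.\<close>

lemma linear_term_zero:
  fixes b c :: real
  assumes "\<And>t. 0 \<le> 2 * t * b + t\<^sup>2 * c"
  shows "b = 0" and "0 \<le> c"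
proof -
  show "0 \<le> c"
    using assms[of 1] assms[of "-1"] by simp
  show "b = 0"
  proof (rule ccontr)
    assume "b \<noteq> 0"
    \<comment> \<open>The minimiser would be \<open>- b / c\<close>; the denominator
      \<open>c + 1\<close> covers \<open>c = 0\<close> as well and still makes the value
      negative.\<close>
    define t where "t = - b / (c + 1)"
    have b: "b = - t * (c + 1)" and "t \<noteq> 0"
      using \<open>0 \<le> c\<close> \<open>b \<noteq> 0\<close> by (simp_all add: t_def)
    have "2 * t * b + t\<^sup>2 * c = - (t\<^sup>2 * (c + 2))"
      unfolding b by (simp add: algebra_simps power2_eq_square)
    moreover have "0 < t\<^sup>2 * (c + 2)"
      using \<open>0 \<le> c\<close> \<open>t \<noteq> 0\<close> by simp
    ultimately show False
      using assms[of t] by linarith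
  qed
qed

locale hermitian_form =
  fixes f :: "'a::complex_vector \<Rightarrow> 'a \<Rightarrow> complex"
  assumes add_left: "f (x + y) z = f x z + f y z"
    and scaleC_left: "f (c *\<^sub>C x) y = c * f x y"
    and herm: "f x y = cnj (f y x)"
begin

lemma add_right: "f x (y + z) = f x y + f x z"
  by (metis add_left complex_cnj_add herm)

lemma scaleC_right: "f x (c *\<^sub>C y) = cnj c * f x y"
  by (metis complex_cnj_mult herm scaleC_left)

lemma zero_left [simp]: "f 0 x = 0"
  using add_left[of 0 0 x] by simp

lemma zero_right [simp]: "f x 0 = 0"
  using add_right[of x 0 0] by simp

lemma minus_left: "f (- x) y = - f x y"
  using add_left[of x "- x" y] by (simp add: eq_neg_iff_add_eq_0 add.commute)

lemma minus_right: "f x (- y) = - f x y"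
  using add_right[of x y "- y"] by (simp add: eq_neg_iff_add_eq_0 add.commute)

lemma diff_left: "f (x - y) z = f x z - f y z"
  using add_left[of x "- y" z] by (simp add: minus_left)

lemma diff_right: "f x (y - z) = f x y - f x z"
  using add_right[of x y "- z"] by (simp add: minus_right)

lemma Im_self [simp]: "Im (f x x) = 0"
  using herm[of x x] by (metis Reals_cnj_iff complex_is_Real_iff)

lemma Re_commute: "Re (f y x) = Re (f x y)"
  using herm[of x y] by simp

lemma Re_add_self: "Re (f (x + y) (x + y)) = Re (f x x) + 2 * Re (f x y) + Re (f y y)"
  using Re_commute[of x y] by (simp add: add_left add_right)

lemma Re_diff_self: "Re (f (x - y) (x - y)) = Re (f x x) - 2 * Re (f x y) + Re (f y y)"
  using Re_commute[of x y] by (simp add: diff_left diff_right)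

lemma Re_scaleC_self: "Re (f (c *\<^sub>C x) (c *\<^sub>C x)) = (cmod c)\<^sup>2 * Re (f x x)"
proof -
  have "f (c *\<^sub>C x) (c *\<^sub>C x) = (c * cnj c) * f x x"
    by (simp add: scaleC_left scaleC_right)
  then show ?thesis
    by (simp add: complex_norm_square [symmetric])
qed

text \<open>Expansion in \<open>c\<close> leaves \<open>2 * Re (cnj c * f r v)\<close> plus a
  multiple of \<open>(cmod c)\<^sup>2\<close>. Real \<open>c\<close> tests the real part of
  \<open>f r v\<close>, imaginary \<open>c\<close> the imaginary part, and
  \<open>linear_term_zero\<close> kills both.\<close>

lemma minimal_imp_orthogonal:
  assumes "\<And>c. Re (f r r) \<le> Re (f (r + c *\<^sub>C v) (r + c *\<^sub>C v))"
  shows "f r v = 0" and "0 \<le> Re (f v v)"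
proof -
  have *: "0 \<le> 2 * Re (cnj c * f r v) + (cmod c)\<^sup>2 * Re (f v v)" for c
    using assms[of c] by (simp only: Re_add_self Re_scaleC_self) (simp add: scaleC_right)
  have 1: "0 \<le> 2 * t * Re (f r v) + t\<^sup>2 * Re (f v v)" for t
    using *[of "complex_of_real t"] by simp
  have 2: "0 \<le> 2 * t * Im (f r v) + t\<^sup>2 * Re (f v v)" for t
    using *[of "\<i> * complex_of_real t"] by (simp add: norm_mult)
  show "f r v = 0"
    using linear_term_zero(1)[OF 1] linear_term_zero(1)[OF 2] by (simp add: complex_eq_iff)
  show "0 \<le> Re (f v v)"
    using linear_term_zero(2)[OF 1] .
qed

end


section \<open>Complex inner product spaces and Hilbert spaces\<close>

locale complex_inner = hermitian_form +
  assumes pos: "x \<noteq> 0 \<Longrightarrow> 0 < Re (f x x)"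
begin

section \<open>The norm of a positive definite form\<close>

definition nrm :: "'a \<Rightarrow> real" where
  "nrm x = sqrt (Re (f x x))"

lemma nonneg: "0 \<le> Re (f x x)"
  using pos[of x] by (cases "x = 0") auto

lemma nrm_ge_0 [simp]: "0 \<le> nrm x"
  by (simp add: nrm_def nonneg)

lemma nrm_square: "(nrm x)\<^sup>2 = Re (f x x)"
  by (simp add: nrm_def nonneg)

lemma self_eq_nrm: "f x x = complex_of_real ((nrm x)\<^sup>2)"
  by (simp add: complex_eq_iff nrm_square)

lemma nrm_0 [simp]: "nrm 0 = 0"
  by (simp add: nrm_def)

lemma nrm_eq_0 [simp]: "nrm x = 0 \<longleftrightarrow> x = 0"
  using pos[of x] by (cases "x = 0") (auto simp: nrm_def)

lemma nrm_scaleC: "nrm (c *\<^sub>C x) = cmod c * nrm x"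
  by (simp add: nrm_def Re_scaleC_self real_sqrt_mult)

lemma nrm_minus [simp]: "nrm (- x) = nrm x"
  by (simp add: nrm_def minus_left minus_right)

lemma nrm_minus_commute: "nrm (x - y) = nrm (y - x)"
  by (metis minus_diff_eq nrm_minus)

lemma Cauchy_Schwarz: "cmod (f x y) \<le> nrm x * nrm y"
proof (cases "y = 0")
  case False
  then have y: "0 < nrm y"
    by (metis less_eq_real_def nrm_eq_0 nrm_ge_0)
  \<comment> \<open>\<open>c *\<^sub>C y\<close> is the orthogonal projection of \<open>x\<close>
    onto the line through \<open>y\<close>; the inequality says that the squared norm of the
    remainder is nonnegative.\<close>
  define c where "c = f x y / (nrm y)\<^sup>2"
  have fyx: "f y x = cnj (f x y)"
    by (rule herm)
  have "Re (f (x - c *\<^sub>C y) (x - c *\<^sub>C y)) = (nrm x)\<^sup>2 - (cmod (f x y))\<^sup>2 / (nrm y)\<^sup>2"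
  proof -
    have "Re (f x (c *\<^sub>C y)) = (cmod (f x y))\<^sup>2 / (nrm y)\<^sup>2"
    proof -
      have "f x (c *\<^sub>C y) = f x y * cnj (f x y) / (nrm y)\<^sup>2"
        by (simp add: scaleC_right c_def)
      also have "\<dots> = complex_of_real ((cmod (f x y))\<^sup>2 / (nrm y)\<^sup>2)"
        by (simp only: complex_norm_square[symmetric] of_real_divide)
      finally show ?thesis by simp
    qed
    moreover have "Re (f (c *\<^sub>C y) (c *\<^sub>C y)) = (cmod (f x y))\<^sup>2 / (nrm y)\<^sup>2"
      using y by (subst Re_scaleC_self)
        (simp add: c_def nrm_square[symmetric] norm_divide norm_mult norm_power power_divide power2_eq_square)
    ultimately show ?thesis
      by (simp add: Re_diff_self nrm_square)
  qed
  then have "(cmod (f x y))\<^sup>2 / (nrm y)\<^sup>2 \<le> (nrm x)\<^sup>2"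
    using nonneg[of "x - c *\<^sub>C y"] by simp
  then have "(cmod (f x y))\<^sup>2 \<le> (nrm x * nrm y)\<^sup>2"
    using y by (simp only: pos_divide_le_eq zero_less_power power_mult_distrib)
  then show ?thesis
    by (rule power2_le_imp_le) simp
qed simp

lemma nrm_triangle: "nrm (x + y) \<le> nrm x + nrm y"
proof (rule power2_le_imp_le)
  have "Re (f x y) \<le> nrm x * nrm y"
    using Cauchy_Schwarz[of x y] complex_Re_le_cmod order_trans by blast
  then show "(nrm (x + y))\<^sup>2 \<le> (nrm x + nrm y)\<^sup>2"
    by (simp add: nrm_square Re_add_self power2_sum)
qed simp

lemma nrm_triangle_diff: "nrm (x - z) \<le> nrm (x - y) + nrm (y - z)"
  using nrm_triangle[of "x - y" "y - z"] by simp

lemma nrm_triangle_sub: "nrm x \<le> nrm y + nrm (x - y)"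
  using nrm_triangle[of y "x - y"] by simp

text \<open>The functional given by \<open>x\<close> attains its norm at the normalised
  \<open>x\<close>. This converts bounds on functionals into bounds on norms.\<close>

lemma nrm_le_if_functionals_le:
  assumes "0 \<le> C" and "\<And>y. nrm y \<le> 1 \<Longrightarrow> cmod (f x y) \<le> C"
  shows "nrm x \<le> C"
proof (cases "x = 0")
  case False
  then have x: "0 < nrm x"
    by (metis less_eq_real_def nrm_eq_0 nrm_ge_0)
  have "cmod (f x ((1 / nrm x) *\<^sub>C x)) \<le> C"
    using x by (intro assms) (simp add: nrm_scaleC norm_divide)
  then show ?thesis
    using x False by (simp add: scaleC_right self_eq_nrm norm_mult norm_divide norm_power power2_eq_square)
qed (use assms in simp)

lemma orthogonal_limit:
  assumes "(\<lambda>n. nrm (X n - p)) \<longlonglongrightarrow> 0" and "\<And>n. f q (X n) = 0"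
  shows "f q p = 0"
proof -
  have "cmod (f q p) \<le> nrm q * nrm (X n - p)" for n
    using Cauchy_Schwarz[of q "X n - p"] assms(2)[of n] by (simp add: diff_right)
  moreover have "(\<lambda>n. nrm q * nrm (X n - p)) \<longlonglongrightarrow> 0"
    using tendsto_mult_right_zero[OF assms(1)] .
  ultimately have "cmod (f q p) \<le> 0"
    by (intro LIMSEQ_le_const) auto
  then show ?thesis by simp
qed

text \<open>Needed when a functional bound is known only on a subspace having \<open>u\<close> in
  its closure. Replacing \<open>u\<close> by \<open>X n\<close> in the second argument of
  \<open>f u u\<close> costs an error that tends to 0, so in the limit
  \<open>(nrm u)\<^sup>2\<close> is at most \<open>K * nrm u\<close>.\<close>

lemma nrm_le_if_limit:
  assumes lim: "(\<lambda>n. nrm (X n - u)) \<longlonglongrightarrow> 0" and "0 \<le> K"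
    and bound: "\<And>n. cmod (f u (X n)) \<le> K * nrm (X n)"
  shows "nrm u \<le> K"
proof (cases "u = 0")
  case False
  then have u: "0 < nrm u"
    by (metis less_eq_real_def nrm_eq_0 nrm_ge_0)
  have "(nrm u)\<^sup>2 \<le> K * (nrm u + nrm (X n - u)) + nrm u * nrm (X n - u)" for n
  proof -
    have "(nrm u)\<^sup>2 = cmod (f u (X n) - f u (X n - u))"
      by (simp add: diff_right self_eq_nrm norm_power)
    also have "\<dots> \<le> cmod (f u (X n)) + cmod (f u (X n - u))"
      by (rule norm_triangle_ineq4)
    also have "\<dots> \<le> K * (nrm u + nrm (X n - u)) + nrm u * nrm (X n - u)"
      using bound[of n] mult_left_mono[OF nrm_triangle_sub[of "X n" u] \<open>0 \<le> K\<close>]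
        Cauchy_Schwarz[of u "X n - u"] by linarith
    finally show ?thesis .
  qed
  moreover have "(\<lambda>n. K * (nrm u + nrm (X n - u)) + nrm u * nrm (X n - u)) \<longlonglongrightarrow>
      K * (nrm u + 0) + nrm u * 0"
    by (intro tendsto_intros lim)
  ultimately have "(nrm u)\<^sup>2 \<le> K * (nrm u + 0) + nrm u * 0"
    using LIMSEQ_le_const by blast
  then show ?thesis
    using u by (simp add: power2_eq_square)
qed (use assms in simp)

text \<open>The bridge from the completeness of one component of a fundamental decomposition to
  convergence in \<open>nrm\<close>. There \<open>g\<close> is the indefinite form or its negative,
  which matches \<open>f\<close> only on \<open>S\<close>; \<open>g_minus\<close> gives the symmetry
  of \<open>form_dist g\<close> that \<open>Metric_space\<close> demands outside \<open>S\<close>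
  too.\<close>

lemma mcomplete_imp_convergent:
  assumes S: "csubspace S" and g: "\<And>x. x \<in> S \<Longrightarrow> cmod (g x x) = Re (f x x)"
    and g_minus: "\<And>x. g (- x) (- x) = g x x"
    and complete: "Metric_space.mcomplete S (form_dist g)"
    and X: "\<And>n::nat. X n \<in> S"
    and Cauchy: "\<And>e. 0 < e \<Longrightarrow> \<exists>N. \<forall>m\<ge>N. \<forall>n\<ge>N. nrm (X m - X n) < e"
  obtains l where "(\<lambda>n. nrm (X n - l)) \<longlonglongrightarrow> 0"
proof -
  have "x - y \<in> S" if "x \<in> S" "y \<in> S" for x y
  proof -
    have "x + (-1) *\<^sub>C y \<in> S"
      using S that unfolding csubspace_def by blast
    then show ?thesis
      by (simp add: scaleC_one)
  qed
  then have dist: "form_dist g x y = nrm (x - y)" if "x \<in> S" "y \<in> S" for x y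
    using that by (simp add: form_dist_def g nrm_def)
  interpret Metric_space S "form_dist g"
  proof
    show "form_dist g x y = form_dist g y x" for x y
      using g_minus[of "x - y"] by (simp add: form_dist_def)
    show "form_dist g x z \<le> form_dist g x y + form_dist g y z"
      if "x \<in> S" "y \<in> S" "z \<in> S" for x y z
      using that nrm_triangle_diff by (simp add: dist)
  qed (auto simp: dist, simp add: form_dist_def)
  have "MCauchy X"
    unfolding MCauchy_def using X Cauchy by (simp add: dist image_subset_iff)
  then obtain l where "l \<in> S" "(\<lambda>n. form_dist g (X n) l) \<longlonglongrightarrow> 0"
    using complete by (auto simp: mcomplete_def limitin_metric_dist_null)
  then show ?thesis
    using X by (intro that[of l]) (simp add: dist)
qed

end

text \<open>Completeness is stated through \<open>nrm\<close> because the norm belongs to the form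
  and not to the type, which carries one such norm for each fundamental decomposition.\<close>

locale complex_hilbert = complex_inner +
  assumes complete:
    "(\<And>e. 0 < e \<Longrightarrow> \<exists>N. \<forall>m\<ge>N. \<forall>n\<ge>N. nrm (X m - X n) < e) \<Longrightarrow> \<exists>l. (\<lambda>n. nrm (X n - l)) \<longlonglongrightarrow> 0"
begin

text \<open>The projection theorem for the closure of \<open>S\<close>, with membership of
  \<open>p\<close> in it witnessed by \<open>X\<close>. A minimising sequence for the distance to
  \<open>z\<close> is Cauchy, and minimality of its limit forces orthogonality.\<close>

lemma orthogonal_decomposition:
  assumes S: "csubspace S"
  obtains X p where "\<And>n::nat. X n \<in> S" and "(\<lambda>n. nrm (X n - p)) \<longlonglongrightarrow> 0"
    and "\<And>s. s \<in> S \<Longrightarrow> f (z - p) s = 0"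
proof -
  have S0: "0 \<in> S" and Sadd: "\<And>x y. x \<in> S \<Longrightarrow> y \<in> S \<Longrightarrow> x + y \<in> S"
    and Sscale: "\<And>c x. x \<in> S \<Longrightarrow> c *\<^sub>C x \<in> S"
    using S by (auto simp: csubspace_def)
  define D where "D = (\<lambda>s. Re (f (z - s) (z - s))) ` S"
  define d where "d = Inf D"
  have "D \<noteq> {}" "bdd_below D"
    using S0 nonneg by (auto simp: D_def intro!: bdd_belowI2)
  then have d_le: "d \<le> Re (f (z - s) (z - s))" if "s \<in> S" for s
    using that by (auto simp: d_def D_def intro!: cInf_lower)
  have "\<exists>s. s \<in> S \<and> Re (f (z - s) (z - s)) < d + inverse (real (Suc n))" for n
  proof -
    have "Inf D < d + inverse (real (Suc n))"
      by (simp add: d_def)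
    from cInf_lessD[OF \<open>D \<noteq> {}\<close> this] show ?thesis
      by (auto simp: D_def)
  qed
  then obtain X where XS: "\<And>n. X n \<in> S"
    and X: "\<And>n. Re (f (z - X n) (z - X n)) < d + inverse (real (Suc n))"
    by metis
  have par: "(nrm (X m - X n))\<^sup>2 \<le> 2 * inverse (real (Suc m)) + 2 * inverse (real (Suc n))" for m n
  proof -
    let ?a = "z - X m" and ?b = "z - X n"
    \<comment> \<open>The midpoint lies in \<open>S\<close>, so its squared distance to
      \<open>z\<close> is at least \<open>d\<close>; the parallelogram law then bounds
      \<open>X m - X n\<close> by the excess of the two near-minimal values.\<close>
    let ?h = "(1/2) *\<^sub>C (X m + X n)"
    have "z = (1/2) *\<^sub>C (z + z)"
      using scaleC_add_left[of "1/2" "1/2" z] by (simp add: scaleC_one scaleC_add_right)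
    then have "?a + ?b = 2 *\<^sub>C (z - ?h)"
      using scaleC_add_left[of 1 1 z]
      by (simp add: complex_vector.scale_right_diff_distrib scaleC_scaleC scaleC_one algebra_simps)
    then have "Re (f (?a + ?b) (?a + ?b)) = 4 * Re (f (z - ?h) (z - ?h))"
      by (simp only: Re_scaleC_self) simp
    moreover have "d \<le> Re (f (z - ?h) (z - ?h))"
      using d_le Sscale Sadd XS by blast
    moreover have "Re (f (?a - ?b) (?a - ?b)) + Re (f (?a + ?b) (?a + ?b))
        = 2 * Re (f ?a ?a) + 2 * Re (f ?b ?b)"
      by (simp only: Re_add_self Re_diff_self) simp
    moreover have "(nrm (X m - X n))\<^sup>2 = Re (f (?a - ?b) (?a - ?b))"
      by (simp add: nrm_minus_commute[of "X m"] nrm_square[symmetric])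
    ultimately show ?thesis
      using X[of m] X[of n] by linarith
  qed
  have "\<exists>N. \<forall>m\<ge>N. \<forall>n\<ge>N. nrm (X m - X n) < e" if e: "0 < e" for e
  proof -
    obtain N where N: "inverse (real (Suc N)) < e\<^sup>2 / 4"
      using reals_Archimedean[of "e\<^sup>2 / 4"] e by auto
    have "nrm (X m - X n) < e" if "N \<le> m" "N \<le> n" for m n
    proof (rule power2_less_imp_less)
      have "inverse (real (Suc m)) \<le> inverse (real (Suc N))"
        "inverse (real (Suc n)) \<le> inverse (real (Suc N))"
        using that by (auto intro!: le_imp_inverse_le)
      then show "(nrm (X m - X n))\<^sup>2 < e\<^sup>2"
        using par[of m n] N by linarith
    qed (use e in simp)
    then show ?thesis by blast
  qed
  then obtain p where p: "(\<lambda>n. nrm (X n - p)) \<longlonglongrightarrow> 0"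
    using complete by blast
  have near: "(\<lambda>n. (nrm (z - X n))\<^sup>2) \<longlonglongrightarrow> d"
  proof (rule real_tendsto_sandwich
      [where f = "\<lambda>_. d" and h = "\<lambda>n. d + inverse (real (Suc n))"])
    show "(\<lambda>n. d + inverse (real (Suc n))) \<longlonglongrightarrow> d"
      using tendsto_add[OF tendsto_const[of d] LIMSEQ_inverse_real_of_nat] by simp
    show "\<forall>\<^sub>F n in sequentially. d \<le> (nrm (z - X n))\<^sup>2"
      using d_le XS by (simp add: nrm_square)
    show "\<forall>\<^sub>F n in sequentially. (nrm (z - X n))\<^sup>2 \<le> d + inverse (real (Suc n))"
      using X by (auto simp: nrm_square less_imp_le)
  qed simp
  have nrm_tendsto: "(\<lambda>n. nrm (y - X n)) \<longlonglongrightarrow> nrm (y - p)" for y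
  proof -
    have "norm (nrm (y - X n) - nrm (y - p)) \<le> nrm (X n - p)" for n
      using nrm_triangle_diff[of y p "X n"] nrm_triangle_diff[of y "X n" p]
        nrm_minus_commute[of p "X n"] by (simp add: abs_le_iff)
    then have "(\<lambda>n. nrm (y - X n) - nrm (y - p)) \<longlonglongrightarrow> 0"
      by (intro Lim_null_comparison[OF _ p] always_eventually) blast
    then show ?thesis
      by (simp add: LIM_zero_iff)
  qed
  have zp: "(nrm (z - p))\<^sup>2 = d"
    using LIMSEQ_unique[OF tendsto_power[OF nrm_tendsto] near] .
  \<comment> \<open>Minimality against \<open>p - s\<close>, which need not lie in \<open>S\<close>,
    is the limit of minimality against \<open>X n - s\<close>, which does.\<close>
  have ge: "d \<le> (nrm (z + s - p))\<^sup>2" if s: "s \<in> S" for s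
  proof (rule LIMSEQ_le_const[OF tendsto_power[OF nrm_tendsto]])
    have "d \<le> (nrm (z + s - X n))\<^sup>2" for n
      using d_le[OF Sadd[OF XS Sscale[OF s]], of n "-1"]
      by (simp add: nrm_square scaleC_one algebra_simps)
    then show "\<exists>N. \<forall>n\<ge>N. d \<le> (nrm (z + s - X n))\<^sup>2" by blast
  qed
  have "f (z - p) s = 0" if "s \<in> S" for s
  proof (rule minimal_imp_orthogonal)
    show "Re (f (z - p) (z - p)) \<le> Re (f (z - p + c *\<^sub>C s) (z - p + c *\<^sub>C s))" for c
      using ge[OF Sscale[OF that, of c]] zp by (simp add: nrm_square algebra_simps)
  qed
  then show ?thesis
    using that XS p by blast
qed

lemma Riesz_representation:
  fixes \<phi> :: "'a \<Rightarrow> complex"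
  assumes add: "\<And>x y. \<phi> (x + y) = \<phi> x + \<phi> y" and scale: "\<And>c x. \<phi> (c *\<^sub>C x) = c * \<phi> x"
    and bound: "\<And>x. cmod (\<phi> x) \<le> C * nrm x"
  obtains w where "\<And>x. \<phi> x = f x w"
proof (cases "\<forall>x. \<phi> x = 0")
  case True
  then show ?thesis using that[of 0] by simp
next
  case False
  then obtain z where z: "\<phi> z \<noteq> 0" by blast
  have \<phi>0: "\<phi> 0 = 0"
    using add[of 0 0] by simp
  have diff: "\<phi> (x - y) = \<phi> x - \<phi> y" for x y
    using add[of "x - y" y] by simp
  have "csubspace {x. \<phi> x = 0}"
    by (auto simp: csubspace_def add scale \<phi>0)
  from orthogonal_decomposition[OF this, of z]
  obtain X p where "\<And>n::nat. X n \<in> {x. \<phi> x = 0}" and X_lim: "(\<lambda>n. nrm (X n - p)) \<longlonglongrightarrow> 0"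
    and "\<And>s. s \<in> {x. \<phi> x = 0} \<Longrightarrow> f (z - p) s = 0"
    by metis
  then have X: "\<phi> (X n) = 0" and orth: "\<phi> s = 0 \<Longrightarrow> f (z - p) s = 0" for n s
    by auto
  \<comment> \<open>The kernel of a bounded functional is closed, so \<open>p\<close> lies in it
    along with the \<open>X n\<close>.\<close>
  have "cmod (\<phi> p) \<le> C * nrm (X n - p)" for n
    using bound[of "X n - p"] X[of n] by (simp add: diff)
  then have "cmod (\<phi> p) \<le> 0"
    using LIMSEQ_le_const[OF tendsto_mult_right_zero[OF X_lim, of C]] by blast
  then have \<phi>p: "\<phi> p = 0" by simp
  let ?q = "z - p"
  have q: "?q \<noteq> 0"
    using \<phi>p z by auto
  show ?thesis
  \<comment> \<open>The scalar is forced by evaluation at \<open>?q\<close>, where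
    \<open>\<phi> ?q = \<phi> z\<close>; the conjugate compensates for antilinearity in the second
    argument.\<close>
  proof (rule that[of "cnj (\<phi> z / f ?q ?q) *\<^sub>C ?q"])
    fix x
    have "\<phi> (\<phi> z *\<^sub>C x - \<phi> x *\<^sub>C ?q) = 0"
      by (simp add: diff scale \<phi>p)
    then have "f ?q (\<phi> z *\<^sub>C x - \<phi> x *\<^sub>C ?q) = 0"
      by (rule orth)
    then have "f (\<phi> z *\<^sub>C x - \<phi> x *\<^sub>C ?q) ?q = 0"
      by (metis complex_cnj_zero herm)
    then have "\<phi> z * f x ?q = \<phi> x * f ?q ?q"
      by (simp only: diff_left scaleC_left) simp
    moreover have "f ?q ?q \<noteq> 0"
      using pos[OF q] by auto
    ultimately have "\<phi> x = \<phi> z / f ?q ?q * f x ?q"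
      by (simp add: nonzero_eq_divide_eq)
    then show "\<phi> x = f x (cnj (\<phi> z / f ?q ?q) *\<^sub>C ?q)"
      by (simp only: scaleC_right complex_cnj_cnj)
  qed
qed

text \<open>
  Were the family not uniformly bounded, then in every ball some member would be large somewhere,
  hence on a smaller closed ball; the common point of a nested sequence of such balls would
  contradict pointwise boundedness.
\<close>

lemma uniform_boundedness:
  fixes F :: "('a \<Rightarrow> complex) set"
  assumes add: "\<And>\<phi> x y. \<phi> \<in> F \<Longrightarrow> \<phi> (x + y) = \<phi> x + \<phi> y"
    and scale: "\<And>\<phi> c x. \<phi> \<in> F \<Longrightarrow> \<phi> (c *\<^sub>C x) = c * \<phi> x"
    and bound: "\<And>\<phi>. \<phi> \<in> F \<Longrightarrow> \<exists>C. \<forall>x. cmod (\<phi> x) \<le> C * nrm x"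
    and pointwise: "\<And>x. \<exists>C. \<forall>\<phi>\<in>F. cmod (\<phi> x) \<le> C"
  obtains C where "0 \<le> C" and "\<And>\<phi> x. \<phi> \<in> F \<Longrightarrow> cmod (\<phi> x) \<le> C * nrm x"
proof (rule ccontr)
  note result = that
  assume contra: "\<not> thesis"
  have unbounded: "\<exists>\<phi>\<in>F. \<exists>x. C * nrm x < cmod (\<phi> x)" if "0 \<le> C" for C
  proof (rule ccontr)
    assume "\<not> ?thesis"
    then have "cmod (\<phi> x) \<le> C * nrm x" if "\<phi> \<in> F" for \<phi> x
      using that by (force simp: not_less)
    then show False
      using contra result \<open>0 \<le> C\<close> by blast
  qed
  have zero: "\<phi> 0 = 0" if "\<phi> \<in> F" for \<phi>
    using add[OF that, of 0 0] by simp
  have diff: "\<phi> (x - y) = \<phi> x - \<phi> y" if "\<phi> \<in> F" for \<phi> x y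
    using add[OF that, of "x - y" y] by simp
  \<comment> \<open>A bound \<open>k\<close> on the ball of radius \<open>r\<close> around
    \<open>a\<close> gives, by taking differences, the bound \<open>2 * k\<close> at radius
    \<open>r\<close> around 0, hence the uniform bound \<open>2 * k / r\<close> that
    \<open>unbounded\<close> excludes.\<close>
  have large: "\<exists>\<phi>\<in>F. \<exists>x. nrm (x - a) \<le> r \<and> k < cmod (\<phi> x)" if r: "0 < r" and k: "0 \<le> k" for a r k
  proof (rule ccontr)
    assume "\<not> ?thesis"
    then have small: "cmod (\<phi> x) \<le> k" if "\<phi> \<in> F" "nrm (x - a) \<le> r" for \<phi> x
      using that by force
    obtain \<phi> x where \<phi>: "\<phi> \<in> F" and x: "(2 * k / r) * nrm x < cmod (\<phi> x)"
      using unbounded[of "2 * k / r"] r k by auto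
    have "x \<noteq> 0"
      using x zero[OF \<phi>] by auto
    then have nx: "0 < nrm x"
      by (metis less_eq_real_def nrm_eq_0 nrm_ge_0)
    let ?y = "complex_of_real (r / nrm x) *\<^sub>C x"
    have ny: "nrm ?y = r"
      using nx r \<open>x \<noteq> 0\<close> by (simp add: nrm_scaleC norm_divide)
    have "cmod (\<phi> ?y) = cmod (\<phi> (a + ?y) - \<phi> a)"
      by (simp add: add[OF \<phi>])
    also have "\<dots> \<le> cmod (\<phi> (a + ?y)) + cmod (\<phi> a)"
      by (rule norm_triangle_ineq4)
    also have "\<dots> \<le> 2 * k"
      using small[OF \<phi>, of "a + ?y"] small[OF \<phi>, of a] ny r by simp
    finally have "r / nrm x * cmod (\<phi> x) \<le> 2 * k"
      using r nx by (simp add: scale[OF \<phi>] norm_mult norm_divide)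
    then show False
      using x r nx by (simp add: field_simps)
  qed
  \<comment> \<open>The bound on the radius makes the centres Cauchy; the lower bound
    \<open>k\<close> on a whole ball survives at the common point.\<close>
  define good where "good = (\<lambda>k (a, r). 0 < r \<and> r \<le> inverse (real (Suc k)) \<and>
    (\<exists>\<phi>\<in>F. \<forall>x. nrm (x - a) \<le> r \<longrightarrow> real k \<le> cmod (\<phi> x)))"
  define sub where "sub = (\<lambda>(a, r::real) (b, s). nrm (b - a) + s \<le> r)"
  have step: "\<exists>b s. good k (b, s) \<and> sub (a, r) (b, s)" if r: "0 < r" for k a r
  proof -
    obtain \<phi> b where \<phi>: "\<phi> \<in> F" and b: "nrm (b - a) \<le> r / 2" and big: "real k < cmod (\<phi> b)"
      using large[of "r / 2" "real k" a] r by auto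
    obtain C where "\<And>x. cmod (\<phi> x) \<le> C * nrm x"
      using bound[OF \<phi>] by blast
    then have C: "cmod (\<phi> x) \<le> max 1 C * nrm x" for x
      by (meson max.cobounded2 mult_right_mono nrm_ge_0 order_trans)
    \<comment> \<open>The first entry keeps the new ball inside the old one, the second shrinks the
      radii to 0, and the third stops \<open>\<phi>\<close>, which has Lipschitz constant
      \<open>max 1 C\<close>, from falling below \<open>k\<close> on the new ball.\<close>
    define s where "s = min (r / 2) (min (inverse (real (Suc k))) ((cmod (\<phi> b) - real k) / max 1 C))"
    have "0 < s"
      using r big by (auto simp: s_def)
    moreover have "real k \<le> cmod (\<phi> x)" if "nrm (x - b) \<le> s" for x
    proof -
      have "cmod (\<phi> (x - b)) \<le> max 1 C * s"
        using C[of "x - b"] that by (meson max.cobounded1 mult_left_mono order_trans zero_le_one)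
      also have "\<dots> \<le> max 1 C * ((cmod (\<phi> b) - real k) / max 1 C)"
        by (rule mult_left_mono) (auto simp: s_def)
      also have "\<dots> = cmod (\<phi> b) - real k"
        by simp
      finally show ?thesis
        using norm_triangle_ineq2[of "\<phi> b" "\<phi> x"] by (simp add: diff[OF \<phi>] norm_minus_commute)
    qed
    ultimately have "good k (b, s)"
      using \<phi> by (auto simp: good_def s_def)
    moreover have "sub (a, r) (b, s)"
      using b by (auto simp: sub_def s_def)
    ultimately show ?thesis by blast
  qed
  have "\<exists>u. \<forall>k. good k (u k) \<and> sub (u k) (u (Suc k))"
  proof (rule dependent_nat_choice)
    show "\<exists>x. good 0 x"
      using step[of 1 0 0] by auto
    show "\<exists>y. good (Suc k) y \<and> sub x y" if "good k x" for x k
      using step[of "snd x" "Suc k" "fst x"] that by (auto simp: good_def split: prod.splits)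
  qed
  then obtain u where u: "\<And>k. good k (u k)" "\<And>k. sub (u k) (u (Suc k))"
    by blast
  define a r where "a = fst \<circ> u" and "r = snd \<circ> u"
  have r: "0 < r k" "r k \<le> inverse (real (Suc k))" for k
    using u(1)[of k] by (auto simp: good_def r_def split: prod.splits)
  have nested: "nrm (a (k + j) - a k) \<le> r k - r (k + j)" for k j
  proof (induction j)
    case (Suc j)
    have "nrm (a (k + Suc j) - a (k + j)) + r (k + Suc j) \<le> r (k + j)"
      using u(2)[of "k + j"] by (auto simp: sub_def a_def r_def split: prod.splits)
    then show ?case
      using Suc nrm_triangle_diff[of "a (k + Suc j)" "a k" "a (k + j)"] by simp
  qed simp
  then have ball: "nrm (a m - a k) \<le> r k" if "k \<le> m" for k m
    using nested[of k "m - k"] that r(1)[of m] by simp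
  have "\<exists>N. \<forall>m\<ge>N. \<forall>n\<ge>N. nrm (a m - a n) < e" if "0 < e" for e
  proof -
    obtain N where N: "inverse (real (Suc N)) < e / 2"
      using reals_Archimedean[of "e / 2"] \<open>0 < e\<close> half_gt_zero by blast
    have "nrm (a m - a n) < e" if "N \<le> m" "N \<le> n" for m n
      using ball[OF that(1)] ball[OF that(2)] r(2)[of N] N
        nrm_triangle_diff[of "a m" "a n" "a N"] nrm_minus_commute[of "a n" "a N"] by linarith
    then show ?thesis by blast
  qed
  then obtain l where l: "(\<lambda>n. nrm (a n - l)) \<longlonglongrightarrow> 0"
    using complete by blast
  have in_ball: "nrm (l - a k) \<le> r k" for k
  proof -
    have "(\<lambda>n. r k + nrm (a n - l)) \<longlonglongrightarrow> r k"
      using tendsto_add[OF tendsto_const l] by simp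
    moreover have "nrm (l - a k) \<le> r k + nrm (a n - l)" if "k \<le> n" for n
      using nrm_triangle_diff[of l "a k" "a n"] ball[OF that] nrm_minus_commute[of l "a n"] by linarith
    ultimately show ?thesis
      by (intro LIMSEQ_le_const exI[of _ k]) auto
  qed
  obtain C where C: "\<And>\<phi>. \<phi> \<in> F \<Longrightarrow> cmod (\<phi> l) \<le> C"
    using pointwise by blast
  obtain k where k: "C < real k"
    using reals_Archimedean2 by blast
  have "good k (a k, r k)"
    using u(1)[of k] by (simp add: a_def r_def)
  then obtain \<phi> where \<phi>: "\<phi> \<in> F" and "\<forall>x. nrm (x - a k) \<le> r k \<longrightarrow> real k \<le> cmod (\<phi> x)"
    unfolding good_def by blast
  then have "real k \<le> cmod (\<phi> l)"
    using in_ball[of k] by blast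
  then show False
    using C[OF \<phi>] k by linarith
qed

end

section \<open>Krein spaces\<close>

global_interpretation iip: hermitian_form "iip :: 'a::iip_space \<Rightarrow> 'a \<Rightarrow> complex"
  by unfold_locales (rule iip_add_left iip_scaleC_left iip_commute)+

section \<open>The Hilbert space belonging to one fundamental decomposition\<close>

locale krein_decomposition =
  fixes M N :: "'a::krein_space set"
  assumes decomposition: "fundamental_decomposition M N"
begin

abbreviation P :: "'a \<Rightarrow> 'a" where
  "P \<equiv> proj_along M N"

abbreviation J :: "'a \<Rightarrow> 'a" where
  "J \<equiv> signature_op M N"

lemma subspaces: "csubspace M" "csubspace N"
  using decomposition unfolding fundamental_decomposition_def hilbert_space_on_def by blast+

lemma subspace_minus: "csubspace S \<Longrightarrow> x \<in> S \<Longrightarrow> - x \<in> S" for S :: "'a set"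
  using complex_vector.subspace_neg[of S x] by (simp add: csubspace_iff_subspace)

lemma subspace_add: "csubspace S \<Longrightarrow> x \<in> S \<Longrightarrow> y \<in> S \<Longrightarrow> x + y \<in> S" for S :: "'a set"
  by (simp add: csubspace_def)

lemma subspace_scaleC: "csubspace S \<Longrightarrow> x \<in> S \<Longrightarrow> c *\<^sub>C x \<in> S" for S :: "'a set"
  by (simp add: csubspace_def)

lemma inter: "M \<inter> N = {0}"
  using decomposition by (simp add: fundamental_decomposition_def)

lemma pos_M:
  assumes "x \<in> M" "x \<noteq> 0"
  shows "0 < Re (iip x x)"
proof -
  have "0 < iip x x"
    using decomposition assms unfolding fundamental_decomposition_def hilbert_space_on_def by blast
  then show ?thesis by (simp add: less_complex_def)
qed

lemma neg_N:
  assumes "x \<in> N" "x \<noteq> 0"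
  shows "Re (iip x x) < 0"
proof -
  have "0 < - iip x x"
    using decomposition assms unfolding fundamental_decomposition_def hilbert_space_on_def by blast
  then show ?thesis by (simp add: less_complex_def)
qed

lemma orth: "x \<in> M \<Longrightarrow> y \<in> N \<Longrightarrow> iip x y = 0"
  using decomposition by (simp add: fundamental_decomposition_def)

lemma orth': "x \<in> N \<Longrightarrow> y \<in> M \<Longrightarrow> iip x y = 0"
  using orth[of y x] iip_commute[of x y] by simp

lemma proj_eqI:
  assumes "u \<in> M" "x - u \<in> N"
  shows "P x = u"
  unfolding proj_along_def
proof (rule the_equality)
  fix v assume v: "v \<in> M \<and> x - v \<in> N"
  have "v + - u \<in> M"
    using v assms subspaces(1) by (intro subspace_add subspace_minus) auto
  moreover have "(x - u) + - (x - v) \<in> N"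
    using v assms subspaces(2) by (intro subspace_add subspace_minus) auto
  ultimately have "v - u \<in> M \<inter> N" by simp
  then show "v = u" by (simp add: inter)
qed (use assms in simp)

lemma proj_mem: "P x \<in> M" "x - P x \<in> N"
proof -
  obtain u v where "u \<in> M" "v \<in> N" "x = u + v"
    using decomposition unfolding fundamental_decomposition_def by blast
  then show "P x \<in> M" "x - P x \<in> N"
    using proj_eqI[of u x] by auto
qed

lemma proj_swap: "proj_along N M x = x - P x"
proof -
  show ?thesis
    unfolding proj_along_def[of N M]
  proof (rule the_equality)
    show "v = x - P x" if "v \<in> N \<and> x - v \<in> M" for v
      using proj_eqI[of "x - v" x] that by auto
  qed (use proj_mem in simp)
qed

lemma signature_eq: "J x = P x - (x - P x)"
  by (simp add: signature_op_def proj_swap)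

lemma proj_add: "P (x + y) = P x + P y"
proof (rule proj_eqI)
  have "(x - P x) + (y - P y) \<in> N"
    using proj_mem(2) subspaces(2) subspace_add by blast
  then show "x + y - (P x + P y) \<in> N" by (simp add: algebra_simps)
qed (use proj_mem(1) subspaces(1) subspace_add in blast)

lemma proj_scaleC: "P (c *\<^sub>C x) = c *\<^sub>C P x"
proof (rule proj_eqI)
  have "c *\<^sub>C (x - P x) \<in> N"
    using proj_mem(2) subspaces(2) subspace_scaleC by blast
  then show "c *\<^sub>C x - c *\<^sub>C P x \<in> N"
    by (simp add: complex_vector.scale_right_diff_distrib)
qed (use proj_mem(1) subspaces(1) subspace_scaleC in blast)

lemma proj_diff: "P (x - y) = P x - P y"
  using proj_add[of "x - y" y] by (simp add: algebra_simps)

lemma signature_add: "J (x + y) = J x + J y"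
  by (simp add: signature_eq proj_add algebra_simps)

lemma signature_scaleC: "J (c *\<^sub>C x) = c *\<^sub>C J x"
  by (simp add: signature_eq proj_scaleC complex_vector.scale_right_diff_distrib)

lemma signature_signature [simp]: "J (J x) = x"
proof -
  have "P (J x) = P x"
  proof (rule proj_eqI[OF proj_mem(1)])
    have "- (x - P x) \<in> N"
      using proj_mem(2) subspaces(2) subspace_minus by blast
    then show "J x - P x \<in> N" by (simp add: signature_eq)
  qed
  then show ?thesis by (simp add: signature_eq)
qed

lemma inner_J_eq: "inner_J M N x y = iip (P x) (P y) - iip (x - P x) (y - P y)"
proof -
  have "inner_J M N x y = iip (P x - (x - P x)) (P y + (y - P y))"
    by (simp add: inner_J_def signature_eq)
  also have "\<dots> = iip (P x) (P y) - iip (x - P x) (y - P y)"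
    using proj_mem by (simp only: iip.add_right iip.diff_left[of "P x" "x - P x"] orth orth') simp
  finally show ?thesis .
qed

lemma hermitian_inner_J: "hermitian_form (inner_J M N)"
proof
  show "inner_J M N (x + y) z = inner_J M N x z + inner_J M N y z" for x y z
    by (simp add: inner_J_def signature_add iip_add_left)
  show "inner_J M N (c *\<^sub>C x) y = c * inner_J M N x y" for c x y
    by (simp add: inner_J_def signature_scaleC iip_scaleC_left)
  show "inner_J M N x y = cnj (inner_J M N y x)" for x y
    using iip_commute[of "P x" "P y"] iip_commute[of "x - P x" "y - P y"]
    by (simp only: inner_J_eq complex_cnj_diff)
qed

sublocale J: complex_inner "inner_J M N"
proof (intro complex_inner.intro complex_inner_axioms.intro hermitian_inner_J)
  fix x :: 'a assume "x \<noteq> 0"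
  then have "P x \<noteq> 0 \<or> x - P x \<noteq> 0" by auto
  then show "0 < Re (inner_J M N x x)"
    using pos_M[OF proj_mem(1), of x] neg_N[OF proj_mem(2), of x]
    by (cases "P x = 0"; cases "x - P x = 0") (simp_all add: inner_J_eq)
qed

lemma norm_J_eq: "norm_J M N x = J.nrm x"
  by (simp add: norm_J_def J.nrm_def)

lemma proj_on_M: "x \<in> M \<Longrightarrow> P x = x"
  using subspaces(2) by (intro proj_eqI) (auto simp: csubspace_def)

lemma proj_on_N: "x \<in> N \<Longrightarrow> P x = 0"
  using subspaces(1) by (intro proj_eqI) (auto simp: csubspace_def)

lemma inner_J_split:
  "Re (inner_J M N x x) = Re (inner_J M N (P x) (P x)) + Re (inner_J M N (x - P x) (x - P x))"
  by (simp add: inner_J_eq proj_on_M[OF proj_mem(1)] proj_on_N[OF proj_mem(2)])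

lemma nrm_proj_le: "J.nrm (P x) \<le> J.nrm x" "J.nrm (x - P x) \<le> J.nrm x"
  using J.nonneg[of "P x"] J.nonneg[of "x - P x"] inner_J_split[of x]
  by (simp_all add: J.nrm_def)

text \<open>Both projections are contractions for the norm of \<open>inner_J M N\<close>, so the
  components of a Cauchy sequence are Cauchy in \<open>M\<close> and \<open>N\<close>; their limits
  add up to the limit sought.\<close>

sublocale J: complex_hilbert "inner_J M N"
proof
  fix X :: "nat \<Rightarrow> 'a"
  assume Cauchy: "\<And>e. 0 < e \<Longrightarrow> \<exists>K. \<forall>m\<ge>K. \<forall>n\<ge>K. J.nrm (X m - X n) < e"
  have complete: "Metric_space.mcomplete M (form_dist iip)"
    "Metric_space.mcomplete N (form_dist (\<lambda>x y. - iip x y))"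
    using decomposition unfolding fundamental_decomposition_def hilbert_space_on_def by blast+
  have cmod_self: "cmod (iip x x) = \<bar>Re (iip x x)\<bar>" for x :: 'a
    by (simp add: cmod_def)
  obtain k where k: "(\<lambda>n. J.nrm (P (X n) - k)) \<longlonglongrightarrow> 0"
  proof (rule J.mcomplete_imp_convergent[OF subspaces(1) _ _ complete(1)])
    show "cmod (iip x x) = Re (inner_J M N x x)" if "x \<in> M" for x
      using pos_M[OF that] that by (cases "x = 0") (simp_all add: inner_J_eq proj_on_M cmod_self)
    fix e :: real assume "0 < e"
    then obtain K where K: "\<And>m n. K \<le> m \<Longrightarrow> K \<le> n \<Longrightarrow> J.nrm (X m - X n) < e"
      using Cauchy by blast
    have "J.nrm (P (X m) - P (X n)) < e" if "K \<le> m" "K \<le> n" for m n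
      using K[OF that] nrm_proj_le(1)[of "X m - X n"] by (simp add: proj_diff)
    then show "\<exists>K. \<forall>m\<ge>K. \<forall>n\<ge>K. J.nrm (P (X m) - P (X n)) < e"
      by blast
  qed (auto simp: proj_mem iip.minus_left iip.minus_right)
  obtain l where l: "(\<lambda>n. J.nrm ((X n - P (X n)) - l)) \<longlonglongrightarrow> 0"
  proof (rule J.mcomplete_imp_convergent[OF subspaces(2) _ _ complete(2), where X = "\<lambda>n. X n - P (X n)"])
    show "cmod (- iip x x) = Re (inner_J M N x x)" if "x \<in> N" for x
      using neg_N[OF that] that by (cases "x = 0") (simp_all add: inner_J_eq proj_on_N cmod_self)
    fix e :: real assume "0 < e"
    then obtain K where K: "\<And>m n. K \<le> m \<Longrightarrow> K \<le> n \<Longrightarrow> J.nrm (X m - X n) < e"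
      using Cauchy by blast
    have "J.nrm (X m - P (X m) - (X n - P (X n))) < e" if "K \<le> m" "K \<le> n" for m n
      using K[OF that] nrm_proj_le(2)[of "X m - X n"] by (simp add: proj_diff algebra_simps)
    then show "\<exists>K. \<forall>m\<ge>K. \<forall>n\<ge>K. J.nrm (X m - P (X m) - (X n - P (X n))) < e"
      by blast
  qed (auto simp: proj_mem iip.minus_left iip.minus_right)
  have le: "J.nrm (X n - (k + l)) \<le> J.nrm (P (X n) - k) + J.nrm ((X n - P (X n)) - l)" for n
    using J.nrm_triangle[of "P (X n) - k" "(X n - P (X n)) - l"] by (simp add: algebra_simps)
  have "(\<lambda>n. J.nrm (P (X n) - k) + J.nrm ((X n - P (X n)) - l)) \<longlonglongrightarrow> 0"
    using tendsto_add[OF k l] by (simp only: add_0)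
  then have "(\<lambda>n. J.nrm (X n - (k + l))) \<longlonglongrightarrow> 0"
    by (rule Lim_null_comparison[rotated]) (simp add: le)
  then show "\<exists>l. (\<lambda>n. J.nrm (X n - l)) \<longlonglongrightarrow> 0" by blast
qed

lemma inner_J_left: "inner_J M N x y = iip (J x) y"
  by (simp add: inner_J_def)

lemma inner_J_right: "inner_J M N x y = iip x (J y)"
  using J.herm[of x y] iip_commute[of x "J y"] by (simp add: inner_J_left)

lemma nrm_signature [simp]: "J.nrm (J x) = J.nrm x"
  by (simp add: J.nrm_def inner_J_left inner_J_right[of x x, unfolded inner_J_left])

lemma iip_bound: "cmod (iip x y) \<le> J.nrm x * J.nrm y"
  using J.Cauchy_Schwarz[of "J x" y] by (simp add: inner_J_left)

text \<open>Since \<open>J\<close> is an isometry and an involution, testing against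
  \<open>inner_J M N\<close> over the unit ball is the same as testing against \<open>iip\<close>, a
  form that no longer mentions the decomposition.\<close>

lemma nrm_le_if_iip_le:
  assumes "0 \<le> C" and "\<And>y. J.nrm y \<le> 1 \<Longrightarrow> cmod (iip x y) \<le> C"
  shows "J.nrm x \<le> C"
  using assms by (intro J.nrm_le_if_functionals_le) (simp_all add: inner_J_right)

end

section \<open>Facts that do not depend on the chosen decomposition\<close>

lemma iip_nondegenerate:
  fixes x :: "'a::krein_space"
  assumes "\<And>y. iip x y = 0"
  shows "x = 0"
proof -
  obtain M N :: "'a set" where "fundamental_decomposition M N"
    using ex_fundamental_decomposition by blast
  then interpret krein_decomposition M N
    by unfold_locales
  show ?thesis
    using nrm_le_if_iip_le[of 0 x] J.nrm_ge_0[of x] by (simp add: assms)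
qed

text \<open>The functionals \<open>iip _ y\<close>, with \<open>y\<close> in the unit ball of the
  second norm, are bounded for the first norm and pointwise bounded by the second. Uniform
  boundedness gives one constant for all of them, and duality in the second norm concludes.\<close>

lemma norm_J_equivalent:
  fixes M N M' N' :: "'a::krein_space set"
  assumes "fundamental_decomposition M N" "fundamental_decomposition M' N'"
  obtains C where "0 \<le> C" and "\<And>x. norm_J M' N' x \<le> C * norm_J M N x"
proof -
  interpret a: krein_decomposition M N using assms by unfold_locales
  interpret b: krein_decomposition M' N' using assms by unfold_locales
  let ?F = "{\<lambda>x. iip x y | y. b.J.nrm y \<le> 1}"
  obtain C where C: "0 \<le> C" "\<And>\<phi> x. \<phi> \<in> ?F \<Longrightarrow> cmod (\<phi> x) \<le> C * a.J.nrm x"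
  proof (rule a.J.uniform_boundedness[of ?F])
    show "\<exists>C. \<forall>x. cmod (\<phi> x) \<le> C * a.J.nrm x" if \<phi>: "\<phi> \<in> ?F" for \<phi>
    proof -
      obtain y where "\<phi> = (\<lambda>x. iip x y)"
        using \<phi> by blast
      then have "cmod (\<phi> x) \<le> a.J.nrm y * a.J.nrm x" for x
        using a.iip_bound[of x y] by (simp add: mult.commute)
      then show ?thesis by blast
    qed
    show "\<exists>C. \<forall>\<phi>\<in>?F. cmod (\<phi> x) \<le> C" for x
    proof (intro exI[of _ "b.J.nrm x"] ballI)
      fix \<phi> assume "\<phi> \<in> ?F"
      then obtain y where y: "b.J.nrm y \<le> 1" "\<phi> = (\<lambda>x. iip x y)" by blast
      show "cmod (\<phi> x) \<le> b.J.nrm x"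
        using b.iip_bound[of x y] mult_left_mono[OF y(1) b.J.nrm_ge_0[of x]] by (simp add: y(2))
    qed
  qed (auto simp: iip_add_left iip_scaleC_left)
  have "b.J.nrm x \<le> C * a.J.nrm x" for x
    using C by (intro b.nrm_le_if_iip_le) auto
  then show ?thesis
    using that C(1) by (simp add: a.norm_J_eq b.norm_J_eq)
qed


section \<open>Bounded operators and adjoints\<close>

text \<open>Equivalence of norms in the domain and in the codomain carries a bound for one pair of
  decompositions to every other pair.\<close>

lemma bounded_opsI:
  fixes T :: "'a::krein_space \<Rightarrow> 'b::krein_space"
  assumes add: "\<And>x y. T (x + y) = T x + T y" and scale: "\<And>c x. T (c *\<^sub>C x) = c *\<^sub>C T x"
    and decomp: "fundamental_decomposition M N" "fundamental_decomposition M' N'"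
    and bound: "\<And>x. norm_J M' N' (T x) \<le> C * norm_J M N x"
  shows "T \<in> bounded_ops"
proof -
  have "\<exists>C. \<forall>x. norm_J S' R' (T x) \<le> C * norm_J S R x"
    if S: "fundamental_decomposition S R" and S': "fundamental_decomposition S' R'" for S R S' R'
  proof -
    interpret a: krein_decomposition M N using decomp by unfold_locales
    obtain D where D: "0 \<le> D" "\<And>x. norm_J S' R' x \<le> D * norm_J M' N' x"
      using norm_J_equivalent[OF decomp(2) S'] by blast
    obtain E where E: "0 \<le> E" "\<And>x. norm_J M N x \<le> E * norm_J S R x"
      using norm_J_equivalent[OF S decomp(1)] by blast
    have "norm_J S' R' (T x) \<le> (D * (\<bar>C\<bar> * E)) * norm_J S R x" for x
    proof -
      have "norm_J M' N' (T x) \<le> \<bar>C\<bar> * norm_J M N x"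
        using bound[of x] mult_right_mono[OF abs_ge_self[of C] a.J.nrm_ge_0[of x]]
        by (simp add: a.norm_J_eq)
      also have "\<dots> \<le> \<bar>C\<bar> * (E * norm_J S R x)"
        using E(2) by (intro mult_left_mono) auto
      finally have "D * norm_J M' N' (T x) \<le> D * (\<bar>C\<bar> * (E * norm_J S R x))"
        using D(1) by (rule mult_left_mono)
      then show ?thesis
        using D(2)[of "T x"] by (simp add: mult.assoc)
    qed
    then show ?thesis by blast
  qed
  then show ?thesis
    using add scale
    by (auto simp: bounded_ops_def Vector_Spaces.linear_iff complex_vector.vector_space_axioms)
qed

lemma bounded_ops_add: "T \<in> bounded_ops \<Longrightarrow> T (x + y) = T x + T y"
  by (simp add: bounded_ops_def Vector_Spaces.linear_iff)

lemma bounded_ops_scaleC: "T \<in> bounded_ops \<Longrightarrow> T (c *\<^sub>C x) = c *\<^sub>C T x"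
  by (simp add: bounded_ops_def Vector_Spaces.linear_iff)

lemma bounded_ops_diff: "T \<in> bounded_ops \<Longrightarrow> T (x - y) = T x - T y"
  using bounded_ops_add[of T "x - y" y] by simp

lemma bounded_ops_bound:
  assumes "T \<in> bounded_ops" "fundamental_decomposition M N" "fundamental_decomposition M' N'"
  obtains C where "0 \<le> C" and "\<And>x. norm_J M' N' (T x) \<le> C * norm_J M N x"
proof -
  interpret krein_decomposition M N using assms by unfold_locales
  obtain C where C: "\<And>x. norm_J M' N' (T x) \<le> C * norm_J M N x"
    using assms unfolding bounded_ops_def by blast
  have "norm_J M' N' (T x) \<le> \<bar>C\<bar> * norm_J M N x" for x
    using C[of x] mult_right_mono[OF abs_ge_self[of C] J.nrm_ge_0[of x]]
    by (simp add: norm_J_eq)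
  then show ?thesis
    using that[of "\<bar>C\<bar>"] by simp
qed

lemma bounded_ops_compose:
  fixes S :: "'b::krein_space \<Rightarrow> 'c::krein_space" and T :: "'a::krein_space \<Rightarrow> 'b"
  assumes S: "S \<in> bounded_ops" and T: "T \<in> bounded_ops"
  shows "S \<circ> T \<in> bounded_ops"
proof -
  obtain M N M' N' M'' N'' where
    fd: "fundamental_decomposition (M :: 'a set) N" "fundamental_decomposition (M' :: 'b set) N'"
      "fundamental_decomposition (M'' :: 'c set) N''"
    using ex_fundamental_decomposition[where 'a = 'a] ex_fundamental_decomposition[where 'a = 'b]
      ex_fundamental_decomposition[where 'a = 'c] by blast
  obtain C where C: "0 \<le> C" "\<And>x. norm_J M'' N'' (S x) \<le> C * norm_J M' N' x"
    using bounded_ops_bound[OF S fd(2,3)] by blast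
  obtain D where D: "0 \<le> D" "\<And>x. norm_J M' N' (T x) \<le> D * norm_J M N x"
    using bounded_ops_bound[OF T fd(1,2)] by blast
  have "norm_J M'' N'' ((S \<circ> T) x) \<le> (C * D) * norm_J M N x" for x
    using C(2)[of "T x"] mult_left_mono[OF D(2)[of x] C(1)] by (simp add: mult.assoc)
  then show ?thesis
    using S T fd by (intro bounded_opsI[where C = "C * D"])
      (auto simp: bounded_ops_add bounded_ops_scaleC)
qed

text \<open>This justifies the \<open>THE\<close> in the definition. Riesz represents
  \<open>iip (T x) y\<close> by some \<open>w\<close> in the Hilbert product, and \<open>J w\<close>
  then represents it in the indefinite one; uniqueness is nondegeneracy.\<close>

lemma iip_adjoint:
  fixes T :: "'a::krein_space \<Rightarrow> 'b::krein_space"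
  assumes T: "T \<in> bounded_ops"
  shows "iip (T x) y = iip x (iip_adjoint T y)"
proof -
  obtain M N M' N' where
    fd: "fundamental_decomposition (M :: 'a set) N" "fundamental_decomposition (M' :: 'b set) N'"
    using ex_fundamental_decomposition[where 'a = 'a] ex_fundamental_decomposition[where 'a = 'b]
    by blast
  interpret a: krein_decomposition M N using fd by unfold_locales
  interpret b: krein_decomposition M' N' using fd by unfold_locales
  obtain C where C: "0 \<le> C" "\<And>x. b.J.nrm (T x) \<le> C * a.J.nrm x"
    using bounded_ops_bound[OF T fd] by (auto simp: a.norm_J_eq b.norm_J_eq)
  have "\<exists>w. \<forall>x. iip (T x) y = iip x w" for y
  proof -
    have "cmod (iip (T x) y) \<le> (C * b.J.nrm y) * a.J.nrm x" for x
      using b.iip_bound[of "T x" y] mult_right_mono[OF C(2)[of x] b.J.nrm_ge_0[of y]]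
      by (simp add: mult_ac)
    then obtain w where "\<And>x. iip (T x) y = inner_J M N x w"
      using a.J.Riesz_representation[of "\<lambda>x. iip (T x) y"]
      by (auto simp: bounded_ops_add[OF T] bounded_ops_scaleC[OF T] iip_add_left iip_scaleC_left)
    then show ?thesis
      by (auto simp: a.inner_J_right)
  qed
  then obtain S where S: "\<And>x y. iip (T x) y = iip x (S y)" by metis
  have "iip_adjoint T = S"
    unfolding iip_adjoint_def
  proof (rule the_equality)
    fix R assume R: "\<forall>x y. iip (T x) y = iip x (R y)"
    have "R y - S y = 0" for y
    proof (rule iip_nondegenerate)
      show "iip (R y - S y) x = 0" for x
        using R S[of x y] iip_commute[of "R y - S y" x] by (simp add: iip.diff_right)
    qed
    then show "R = S" by auto
  qed (simp add: S)
  then show ?thesis by (simp add: S)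
qed

lemma iip_adjoint_right: "T \<in> bounded_ops \<Longrightarrow> iip (iip_adjoint T y) x = iip y (T x)"
  using iip_adjoint[of T x y] iip_commute[of "iip_adjoint T y" x] iip_commute[of y "T x"] by simp

lemma iip_adjoint_bounded_ops:
  fixes T :: "'a::krein_space \<Rightarrow> 'b::krein_space"
  assumes T: "T \<in> bounded_ops"
  shows "iip_adjoint T \<in> bounded_ops"
proof -
  obtain M N M' N' where
    fd: "fundamental_decomposition (M :: 'a set) N" "fundamental_decomposition (M' :: 'b set) N'"
    using ex_fundamental_decomposition[where 'a = 'a] ex_fundamental_decomposition[where 'a = 'b]
    by blast
  interpret a: krein_decomposition M N using fd by unfold_locales
  interpret b: krein_decomposition M' N' using fd by unfold_locales
  obtain C where C: "0 \<le> C" "\<And>x. b.J.nrm (T x) \<le> C * a.J.nrm x"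
    using bounded_ops_bound[OF T fd] by (auto simp: a.norm_J_eq b.norm_J_eq)
  show ?thesis
  proof (rule bounded_opsI[OF _ _ fd(2,1)])
    show "iip_adjoint T (x + y) = iip_adjoint T x + iip_adjoint T y" for x y
    proof -
      have "iip_adjoint T (x + y) - (iip_adjoint T x + iip_adjoint T y) = 0"
        by (rule iip_nondegenerate)
          (simp add: iip.diff_left iip_add_left iip_adjoint_right[OF T])
      then show ?thesis by simp
    qed
    show "iip_adjoint T (c *\<^sub>C x) = c *\<^sub>C iip_adjoint T x" for c x
    proof -
      have "iip_adjoint T (c *\<^sub>C x) - c *\<^sub>C iip_adjoint T x = 0"
        by (rule iip_nondegenerate)
          (simp add: iip.diff_left iip_scaleC_left iip_adjoint_right[OF T])
      then show ?thesis by simp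
    qed
    have "a.J.nrm (iip_adjoint T y) \<le> C * b.J.nrm y" for y
    proof (rule a.nrm_le_if_iip_le)
      fix x assume x: "a.J.nrm x \<le> 1"
      have "cmod (iip (iip_adjoint T y) x) \<le> b.J.nrm y * b.J.nrm (T x)"
        by (simp add: iip_adjoint_right[OF T] b.iip_bound)
      also have "\<dots> \<le> b.J.nrm y * C"
      proof (rule mult_left_mono)
        show "b.J.nrm (T x) \<le> C"
          using C(2)[of x] mult_left_mono[OF x C(1)] by simp
      qed simp
      finally show "cmod (iip (iip_adjoint T y) x) \<le> C * b.J.nrm y"
        by (simp add: mult.commute)
    qed (use C(1) in simp)
    then show "norm_J M N (iip_adjoint T y) \<le> C * norm_J M' N' y" for y
      by (simp add: a.norm_J_eq b.norm_J_eq)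
  qed
qed

section \<open>Douglas factorization\<close>

lemma csubspace_range:
  assumes "\<And>x y. T (x + y) = T x + T y" and "\<And>c x. T (c *\<^sub>C x) = c *\<^sub>C T x"
  shows "csubspace (range T)"
  unfolding csubspace_def
proof (intro conjI ballI allI)
  have "T 0 = 0"
    using assms(1)[of 0 0] by simp
  then show "0 \<in> range T"
    by (metis rangeI)
qed (auto simp: assms[symmetric])

text \<open>
  The factorization of Douglas. The solution \<open>X x\<close> of \<open>B z = C x\<close> is chosen in the closure of
  the range of the Hilbert space adjoint \<open>J B\<^sup># J\<close>, that is, in the orthogonal complement of the
  kernel of \<open>B\<close>. Its inner products with elements of that range are bounded functionals of \<open>x\<close>,
  so the uniform boundedness principle takes the place of the closed graph theorem.
\<close>

lemma bounded_factorization: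
  fixes B :: "'a::krein_space \<Rightarrow> 'b::krein_space" and C :: "'c::krein_space \<Rightarrow> 'b"
  assumes B: "B \<in> bounded_ops" and C: "C \<in> bounded_ops" and range: "range C \<subseteq> range B"
  obtains X where "X \<in> bounded_ops" and "\<And>x. B (X x) = C x"
proof -
  obtain M N M' N' M'' N'' where
    fd: "fundamental_decomposition (M :: 'a set) N" "fundamental_decomposition (M' :: 'b set) N'"
      "fundamental_decomposition (M'' :: 'c set) N''"
    using ex_fundamental_decomposition[where 'a = 'a] ex_fundamental_decomposition[where 'a = 'b]
      ex_fundamental_decomposition[where 'a = 'c] by blast
  interpret a: krein_decomposition M N using fd by unfold_locales
  interpret b: krein_decomposition M' N' using fd by unfold_locales
  interpret c: krein_decomposition M'' N'' using fd by unfold_locales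
  obtain K where K: "0 \<le> K" "\<And>x. b.J.nrm (C x) \<le> K * c.J.nrm x"
    using bounded_ops_bound[OF C fd(3,2)] by (auto simp: b.norm_J_eq c.norm_J_eq)
  \<comment> \<open>The Hilbert space adjoint without its inner signature operator: that operator is
    a bijection, so the range is the same, and pairing with \<open>R w\<close> now gives a plain
    \<open>iip\<close>.\<close>
  define R where "R = (\<lambda>w. a.J (iip_adjoint B w))"
  have inner_R: "inner_J M N x (R w) = iip (B x) w" for x w
    by (simp add: R_def a.inner_J_right iip_adjoint[OF B])
  have inner_R': "inner_J M N (R w) x = iip w (B x)" for x w
    using inner_R[of x w] a.J.herm[of "R w" x] iip_commute[of w "B x"] by simp
  have R_subspace: "csubspace (range R)"
    using iip_adjoint_bounded_ops[OF B]
    by (intro csubspace_range)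
      (simp_all add: R_def bounded_ops_add bounded_ops_scaleC a.signature_add a.signature_scaleC)
  have "\<exists>p Y. B p = C x \<and> (\<forall>n::nat. Y n \<in> range R) \<and> (\<lambda>n. a.J.nrm (Y n - p)) \<longlonglongrightarrow> 0" for x
  proof -
    obtain z where z: "C x = B z"
      using range by blast
    obtain Y p where Y: "\<And>n::nat. Y n \<in> range R" "(\<lambda>n. a.J.nrm (Y n - p)) \<longlonglongrightarrow> 0"
      and orth: "\<And>s. s \<in> range R \<Longrightarrow> inner_J M N (z - p) s = 0"
      using a.J.orthogonal_decomposition[OF R_subspace, of z] by metis
    have "B (z - p) = 0"
      using orth inner_R by (intro iip_nondegenerate) (metis rangeI)
    then have "B p = C x"
      by (simp add: bounded_ops_diff[OF B] z)
    with Y show ?thesis by blast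
  qed
  then obtain X Y where X: "\<And>x. B (X x) = C x" and Y: "\<And>x n::nat. Y x n \<in> range R"
    and lim: "\<And>x. (\<lambda>n. a.J.nrm (Y x n - X x)) \<longlonglongrightarrow> 0"
    by metis
  \<comment> \<open>The chosen solutions are orthogonal to the kernel of \<open>B\<close>, hence
    unique; linearity follows because each defect \<open>?d\<close> below lies in that
    kernel.\<close>
  have orth: "inner_J M N q (X x) = 0" if "B q = 0" for q x
  proof (rule a.J.orthogonal_limit[OF lim])
    show "inner_J M N q (Y x n) = 0" for n
      using Y[of x n] that by (auto simp: inner_R)
  qed
  have X_add: "X (x + y) = X x + X y" for x y
  proof -
    let ?d = "X (x + y) - (X x + X y)"
    have "B ?d = 0"
      by (simp add: bounded_ops_diff[OF B] bounded_ops_add[OF B] bounded_ops_add[OF C] X)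
    then have "inner_J M N ?d ?d = 0"
      by (simp only: a.J.diff_right[of ?d "X (x + y)"] a.J.add_right orth) simp
    then show ?thesis
      using a.J.nrm_eq_0[of ?d] by (simp add: a.J.nrm_def)
  qed
  have X_scale: "X (k *\<^sub>C x) = k *\<^sub>C X x" for k x
  proof -
    let ?d = "X (k *\<^sub>C x) - k *\<^sub>C X x"
    have "B ?d = 0"
      by (simp add: bounded_ops_diff[OF B] bounded_ops_scaleC[OF B] bounded_ops_scaleC[OF C] X)
    then have "inner_J M N ?d ?d = 0"
      by (simp only: a.J.diff_right[of ?d "X (k *\<^sub>C x)"] a.J.scaleC_right orth) simp
    then show ?thesis
      using a.J.nrm_eq_0[of ?d] by (simp add: a.J.nrm_def)
  qed
  \<comment> \<open>Each functional is bounded before anything is known about the norm of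
    \<open>X x\<close>, since pairing with \<open>R w\<close> yields \<open>iip (C x) w\<close>.
    Normalising \<open>s\<close> gives the pointwise bound \<open>a.J.nrm (X x)\<close>; for
    \<open>s = 0\<close> division by zero yields the zero functional.\<close>
  define \<phi> where "\<phi> = (\<lambda>s x. inner_J M N (X x) ((1 / a.J.nrm s) *\<^sub>C s))"
  obtain E where E: "0 \<le> E" "\<And>\<psi> x. \<psi> \<in> \<phi> ` range R \<Longrightarrow> cmod (\<psi> x) \<le> E * c.J.nrm x"
  proof (rule c.J.uniform_boundedness[of "\<phi> ` range R"])
    fix \<psi> assume "\<psi> \<in> \<phi> ` range R"
    then obtain w where \<psi>: "\<psi> = \<phi> (R w)" by blast
    have "cmod (\<psi> x) \<le> (\<bar>1 / a.J.nrm (R w)\<bar> * (K * b.J.nrm w)) * c.J.nrm x" for x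
    proof -
      have "cmod (inner_J M N (X x) (R w)) \<le> b.J.nrm (C x) * b.J.nrm w"
        by (simp add: inner_R X b.iip_bound)
      also have "\<dots> \<le> (K * c.J.nrm x) * b.J.nrm w"
        by (intro mult_right_mono K) simp
      finally have "\<bar>1 / a.J.nrm (R w)\<bar> * cmod (inner_J M N (X x) (R w))
          \<le> \<bar>1 / a.J.nrm (R w)\<bar> * ((K * c.J.nrm x) * b.J.nrm w)"
        by (rule mult_left_mono) simp
      then show ?thesis
        by (simp add: \<psi> \<phi>_def a.J.scaleC_right norm_mult norm_divide mult_ac)
    qed
    then show "\<exists>D. \<forall>x. cmod (\<psi> x) \<le> D * c.J.nrm x" by blast
  next
    fix x
    have "cmod (\<psi> x) \<le> a.J.nrm (X x)" if \<psi>: "\<psi> \<in> \<phi> ` range R" for \<psi>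
    proof -
      obtain s where s: "\<psi> = \<phi> s"
        using \<psi> by blast
      have "cmod (\<psi> x) \<le> a.J.nrm (X x) * a.J.nrm ((1 / a.J.nrm s) *\<^sub>C s)"
        by (simp add: s \<phi>_def a.J.Cauchy_Schwarz)
      also have "\<dots> \<le> a.J.nrm (X x) * 1"
        by (intro mult_left_mono) (simp_all add: a.J.nrm_scaleC norm_divide)
      finally show ?thesis by simp
    qed
    then show "\<exists>D. \<forall>\<psi>\<in>\<phi> ` range R. cmod (\<psi> x) \<le> D" by blast
  qed (auto simp: \<phi>_def X_add X_scale a.J.add_left a.J.scaleC_left)
  have "a.J.nrm (X x) \<le> E * c.J.nrm x" for x
  \<comment> \<open>The uniform bound concerns the range of \<open>R\<close> only; it reaches
    \<open>X x\<close> itself along the approximating sequence \<open>Y x\<close>.\<close>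
  proof (rule a.J.nrm_le_if_limit[OF lim])
    show "cmod (inner_J M N (X x) (Y x n)) \<le> E * c.J.nrm x * a.J.nrm (Y x n)" for n
    proof (cases "Y x n = 0")
      case False
      then have pos: "0 < a.J.nrm (Y x n)"
        using a.J.nrm_ge_0[of "Y x n"] by (simp add: less_le)
      have "cmod (\<phi> (Y x n) x) \<le> E * c.J.nrm x"
        using Y by (intro E) auto
      then show ?thesis
        using pos by (simp add: \<phi>_def a.J.scaleC_right norm_mult norm_divide pos_divide_le_eq)
    qed simp
  qed (use E in simp)
  then have "X \<in> bounded_ops"
    by (intro bounded_opsI[OF X_add X_scale fd(3,1), of E]) (simp add: a.norm_J_eq c.norm_J_eq)
  then show ?thesis
    using that X by blast
qed


section \<open>Weighted least squares\<close>

lemma weighted_form: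
  assumes W: "W \<in> bounded_ops" and self: "W = iip_adjoint W"
  shows "hermitian_form (\<lambda>x y. iip (W x) y)"
proof
  show "iip (W x) y = cnj (iip (W y) x)" for x y
    using iip_adjoint[OF W, of x y] self iip_commute[of x "W y"] by simp
qed (simp_all add: bounded_ops_add[OF W] bounded_ops_scaleC[OF W] iip_add_left iip_scaleC_left)

lemma iip_adjoint_eq_0_iff:
  assumes "A \<in> bounded_ops"
  shows "iip_adjoint A v = 0 \<longleftrightarrow> (\<forall>z. iip v (A z) = 0)"
  using iip_nondegenerate[of "iip_adjoint A v"] by (auto simp: iip_adjoint_right[OF assms, symmetric])

lemma is_WILSS_iff:
  fixes A :: "'k::krein_space \<Rightarrow> 'h::krein_space"
  assumes A: "A \<in> bounded_ops" and W: "W \<in> bounded_ops" and self: "W = iip_adjoint W"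
  shows "is_WILSS W A x u \<longleftrightarrow>
    weighted_nonneg W (range A) \<and> iip_adjoint A (W (A u - x)) = 0"
proof -
  interpret W: hermitian_form "\<lambda>x y. iip (W x) y"
    using weighted_form[OF W self] .
  have nonneg_iff: "weighted_nonneg W (range A) \<longleftrightarrow> (\<forall>z. 0 \<le> Re (iip (W (A z)) (A z)))"
    by (auto simp: weighted_nonneg_def less_eq_complex_def)
  have WILSS_iff: "is_WILSS W A x u \<longleftrightarrow>
      (\<forall>z. Re (iip (W (A u - x)) (A u - x)) \<le> Re (iip (W (A z - x)) (A z - x)))"
    by (auto simp: is_WILSS_def less_eq_complex_def)
  have shift: "A (u + z) - x = (A u - x) + A z" for z
    by (simp add: bounded_ops_add[OF A])
  show ?thesis
  proof
    assume u: "is_WILSS W A x u"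
    have min: "Re (iip (W (A u - x)) (A u - x))
        \<le> Re (iip (W (A u - x + c *\<^sub>C A z)) (A u - x + c *\<^sub>C A z))" for c z
      using u[unfolded WILSS_iff, rule_format, of "u + c *\<^sub>C z"]
      by (simp only: shift bounded_ops_scaleC[OF A])
    show "weighted_nonneg W (range A) \<and> iip_adjoint A (W (A u - x)) = 0"
      unfolding nonneg_iff iip_adjoint_eq_0_iff[OF A]
      using W.minimal_imp_orthogonal[OF min] by blast
  next
    assume u: "weighted_nonneg W (range A) \<and> iip_adjoint A (W (A u - x)) = 0"
    have "Re (iip (W (A u - x)) (A u - x)) \<le> Re (iip (W (A z - x)) (A z - x))" for z
    proof -
      \<comment> \<open>Pythagoras: the normal equation removes the cross term, and the excess is a
        value of the weighted form on the range of \<open>A\<close>.\<close>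
      have "Re (iip (W (A z - x)) (A z - x)) =
          Re (iip (W (A u - x)) (A u - x)) + Re (iip (W (A (z - u))) (A (z - u)))"
      proof -
        have "A z - x = (A u - x) + A (z - u)"
          using shift[of "z - u"] by simp
        moreover have "iip (W (A u - x)) (A (z - u)) = 0"
          using u by (simp add: iip_adjoint_eq_0_iff[OF A])
        ultimately show ?thesis
          by (simp only: W.Re_add_self) simp
      qed
      then show ?thesis
        using u by (simp add: nonneg_iff)
    qed
    then show "is_WILSS W A x u"
      by (simp add: WILSS_iff)
  qed
qed

text \<open>Selfadjointness moves \<open>W\<close> to the other argument, so the second summand in
  (ii) is the kernel of \<open>iip_adjoint A \<circ> W\<close>.\<close>

lemma mem_iip_perp_weighted_range_iff:
  fixes A :: "'k::krein_space \<Rightarrow> 'h::krein_space"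
  assumes A: "A \<in> bounded_ops" and W: "W \<in> bounded_ops" and self: "W = iip_adjoint W"
  shows "h \<in> iip_perp (W ` range A) \<longleftrightarrow> iip_adjoint A (W h) = 0"
  using iip_adjoint[OF W] self by (auto simp: iip_perp_def iip_adjoint_eq_0_iff[OF A])

theorem theorem3p2:
  fixes A :: "'k::separable_krein_space \<Rightarrow> 'h::separable_krein_space"
    and W :: "'h \<Rightarrow> 'h"
  assumes "A \<in> bounded_ops"
    and "W \<in> bounded_ops"
    and "W = iip_adjoint W"
  shows "((\<forall>x. \<exists>u. is_WILSS W A x u) \<longleftrightarrow>
            range A + iip_perp (W ` range A) = UNIV \<and> weighted_nonneg W (range A)) \<and>
         ((\<forall>x. \<exists>u. is_WILSS W A x u) \<longleftrightarrow>
            (\<exists>X\<in>bounded_ops. normal_equation W A X) \<and> weighted_nonneg W (range A)) \<and>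
         ((\<forall>x. \<exists>u. is_WILSS W A x u) \<longleftrightarrow>
            (\<exists>G. indefinite_W_inverse W A G)) \<and>
         ((\<forall>x. \<exists>u. is_WILSS W A x u) \<longrightarrow>
            {G. indefinite_W_inverse W A G} = {X \<in> bounded_ops. normal_equation W A X})"
proof -
  let ?i = "\<forall>x. \<exists>u. is_WILSS W A x u"
  let ?nonneg = "weighted_nonneg W (range A)"
  let ?T = "iip_adjoint A \<circ> W"
  note WILSS = is_WILSS_iff[OF assms]
  have T: "?T \<in> bounded_ops"
    using bounded_ops_compose iip_adjoint_bounded_ops assms(1,2) by blast
  \<comment> \<open>Linearity makes the sign of the residual immaterial: (ii) produces
    \<open>x - A u\<close>, the normal equation \<open>A u - x\<close>.\<close>
  have residual: "?T (y - x) = 0 \<longleftrightarrow> ?T y = ?T x" for x y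
    by (simp only: bounded_ops_diff[OF T] right_minus_eq)
  have i: "?i \<longleftrightarrow> ?nonneg \<and> (\<forall>x. \<exists>u. ?T (A u - x) = 0)"
    by (simp add: WILSS)
  have normal: "normal_equation W A X \<longleftrightarrow> (\<forall>x. ?T (A (X x) - x) = 0)" for X
    by (auto simp: normal_equation_def fun_eq_iff)
  have inverse: "indefinite_W_inverse W A X \<longleftrightarrow>
      X \<in> bounded_ops \<and> normal_equation W A X \<and> ?nonneg" for X
    by (auto simp: indefinite_W_inverse_def WILSS normal)
  have ii: "range A + iip_perp (W ` range A) = UNIV \<longleftrightarrow> (\<forall>x. \<exists>u. ?T (A u - x) = 0)"
  proof -
    have "x \<in> range A + iip_perp (W ` range A) \<longleftrightarrow> (\<exists>u. ?T (A u - x) = 0)" for x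
    proof
      assume "x \<in> range A + iip_perp (W ` range A)"
      then obtain u h where "x = A u + h" "h \<in> iip_perp (W ` range A)"
        by (auto elim: set_plus_elim)
      then have "?T (x - A u) = 0"
        by (simp add: mem_iip_perp_weighted_range_iff[OF assms])
      then show "\<exists>u. ?T (A u - x) = 0"
        unfolding residual by metis
    next
      assume "\<exists>u. ?T (A u - x) = 0"
      then obtain u where "?T (x - A u) = 0"
        unfolding residual by metis
      then have "x - A u \<in> iip_perp (W ` range A)"
        by (simp add: mem_iip_perp_weighted_range_iff[OF assms])
      then have "A u + (x - A u) \<in> range A + iip_perp (W ` range A)"
        by (intro set_plus_intro) auto
      then show "x \<in> range A + iip_perp (W ` range A)" by simp
    qed
    then show ?thesis by auto
  qed
  have iii: "(\<exists>X\<in>bounded_ops. normal_equation W A X) \<longleftrightarrow> (\<forall>x. \<exists>u. ?T (A u - x) = 0)"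
  proof
    assume "\<forall>x. \<exists>u. ?T (A u - x) = 0"
    then have "\<exists>u. ?T (A u) = ?T x" for x
      unfolding residual by blast
    \<comment> \<open>The normal equation for \<open>X\<close> is the factorization of
      \<open>?T\<close> through \<open>?T \<circ> A\<close>, so pointwise solvability is the range
      inclusion that \<open>bounded_factorization\<close> requires.\<close>
    then have "range ?T \<subseteq> range (?T \<circ> A)"
      by (metis (no_types, lifting) comp_apply image_subsetI rangeI)
    then obtain X where "X \<in> bounded_ops" "\<And>x. (?T \<circ> A) (X x) = ?T x"
      using bounded_factorization[OF bounded_ops_compose[OF T assms(1)] T] by metis
    then show "\<exists>X\<in>bounded_ops. normal_equation W A X"
      unfolding normal residual by auto
  qed (auto simp: normal)
  show ?thesis
    \<comment> \<open>Solvability for every \<open>x\<close> contains nonnegativity, under which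
      \<open>inverse\<close> identifies the indefinite inverses with the bounded solutions of the
      normal equation; this gives (iv) and the equality of sets.\<close>
    using i ii iii inverse by blast
qed

end
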